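(* If $n$ is a non-negative integer, then $$\sum_{k=0}^\infty \frac{(-1)^k\left(\frac12\right)_k^3\,(4k+1)\,\left(2O_{k-n}+H_{k+n}\right)}{k!^3\,\prod_{j=1}^n (k+j)(2k-2j+1)}=\frac{(-1)^n}{2^{n-2}}\,\frac{1}{\left(\frac12\right)_n^2}\,\left(2O_n-\ln 2\right)\,\frac1\pi.$$ In particular, $$\sum_{k=0}^\infty (-1)^k\,\frac{\left(\frac12\right)_k^3}{k!^3}\,(4k+1)\,H_{2k}=-\frac{2}{\pi}\ln 2.$$
   Context: $(x)_n=\prod_{j=0}^{n-1}(x+j)$ is the Pochhammer symbol; empty products equal $1$, and $\prod_{j=1}^n (k+j)(2k-2j+1)$ extends over both factors. For non-negative integers $j$, $H_j=\sum_{i=1}^j \frac1i$ and $O_j=\sum_{i=1}^j\frac1{2i-1}$, with $H_0=O_0=0$. For complex $z$ that is not a negative integer, $H_z=\psi(z+1)+\gamma$, where $\psi$ is the digamma function and $\gamma$ is Euler's constant. For negative integers $j$, $O_j$ is defined by the relation $H_{j-1/2}=2O_j-2\ln 2$ (which holds for non-negative $j$); equivalently $O_{-j}=O_j$ for all integers $j$. Infinite series are understood as limits of partial sums (convergence may be conditional). *)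

theory Defs
  imports "HOL-Analysis.Analysis"
begin

text \<open>
  The harmonic number \<open>H\<^sub>z = \<psi>(z + 1) + \<gamma>\<close> for an argument \<open>z\<close> that is not a negative integer.
  At non-negative integers it coincides with \<^const>\<open>harm\<close>.
\<close>

definition harmonic :: "'a \<Rightarrow> 'a::{real_normed_field,banach}" where
  "harmonic z = Digamma (z + 1) + euler_mascheroni"

lemma harmonic_of_nat: "harmonic (of_nat n) = harm n"
  using Digamma_of_nat[of n, where ?'a = 'a] by (simp add: harmonic_def add_ac)

text \<open>
  For negative \<open>j\<close> the value is obtained by solving \<open>H\<^bsub>j - 1/2\<^esub> = 2 O\<^sub>j - 2 ln 2\<close> for \<open>O\<^sub>j\<close>.
\<close>

definition odd_harm :: "int \<Rightarrow> real" where
  "odd_harm j =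
     (if j \<ge> 0 then \<Sum>i=1..nat j. 1 / (2 * real i - 1)
      else (harmonic (of_int j - 1 / 2) + 2 * ln 2) / 2)"

lemma odd_harm_of_nat: "odd_harm (int n) = (\<Sum>i=1..n. 1 / (2 * real i - 1))"
  by (simp add: odd_harm_def)

lemma odd_harm_Suc:
  "odd_harm (int (Suc n)) = odd_harm (int n) + 1 / (2 * real (Suc n) - 1)"
  by (simp only: odd_harm_of_nat) simp

lemma harmonic_half_nonneg:
  "harmonic (real n - 1 / 2) = 2 * odd_harm (int n) - 2 * ln 2"
proof (induction n)
  case 0
  show ?case
    using Digamma_one_half[where ?'a = real] by (simp add: harmonic_def odd_harm_def)
next
  case (Suc n)
  have "Digamma (real n + 1 / 2 + 1) = Digamma (real n + 1 / 2) + 1 / (real n + 1 / 2)"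
    by (rule Digamma_plus1) simp
  moreover have "2 / (2 * real (Suc n) - 1) = 1 / (real n + 1 / 2)"
    by (simp add: field_simps)
  ultimately show ?case
    using Suc.IH odd_harm_Suc[of n] by (simp add: harmonic_def algebra_simps)
qed

lemma harmonic_half:
  "harmonic (real_of_int j - 1 / 2) = 2 * odd_harm j - 2 * ln 2"
proof (cases "j \<ge> 0")
  case True
  then show ?thesis
    using harmonic_half_nonneg[of "nat j"] by simp
qed (simp add: odd_harm_def field_simps)

lemma odd_harm_uminus: "odd_harm (- j) = odd_harm j"
proof -
  have *: "odd_harm (- int n) = odd_harm (int n)" for n
  proof (induction n)
    case (Suc n)
    have "Digamma (- real n - 1 / 2 + 1)
        = Digamma (- real n - 1 / 2) + 1 / (- real n - 1 / 2)"
      by (rule Digamma_plus1) (simp add: field_simps)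
    then have "2 * odd_harm (- int n)
        = 2 * odd_harm (- int (Suc n)) + 1 / (- real n - 1 / 2)"
      using harmonic_half[of "- int n"] harmonic_half[of "- int (Suc n)"]
      by (simp add: harmonic_def algebra_simps)
    moreover have "1 / (- real n - 1 / 2) = - 2 / (2 * real (Suc n) - 1)"
      by (simp add: field_simps)
    ultimately show ?case
      using Suc.IH odd_harm_Suc[of n] by simp
  qed simp
  show ?thesis
    using *[of "nat j"] *[of "nat (- j)"] by (cases "j \<ge> 0") simp_all
qed

end

theory Submission
  imports Defs
begin

text \<open>
  Write \<open>a\<^sub>k = (1/2)\<^sub>k / k!\<close> and \<open>r\<^sub>k(y) = (\<Prod>j<k. (y - j) / (y + 3/2 + j))\<close>.  The series of the theorem
  comes from differentiating, with respect to \<open>y\<close>, the evaluation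

    \<open>(\<Sum>k. (4 k + 1) a\<^sub>k\<^sup>2 r\<^sub>k(y)) = \<Phi>(y)\<close>,  where  \<open>\<Phi>(y) = \<Gamma>(y + 3/2) / (\<Gamma>(3/2) \<Gamma>(y + 1))\<close>,

  and setting \<open>y = n - 1/2\<close>.  At this point the logarithmic derivative of \<open>r\<^sub>k\<close> equals
  \<open>(2 O(n) + H(n)) - (2 O(k - n) + H(k + n))\<close>, and that of \<open>\<Phi>\<close> equals
  \<open>H(n) - 2 O(n) + 2 ln 2\<close>.  Hence \<open>(2 O(n) + H(n)) \<Phi> - \<Phi>'\<close> is, up to a factor depending on \<open>n\<close> only,
  the series in question.  The second formula is half of the case \<open>n = 0\<close>, as
  \<open>H(2 k) = O(k) + H(k) / 2\<close>.

  The evaluation rests on the recurrence \<open>(y + 1) \<Phi>(y + 1) = (y + 3/2) \<Phi>(y)\<close>, which the partial sums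
  of the series satisfy up to an explicit boundary term (\<open>telescoping\<close>).  At \<open>y = 0\<close> the series
  reduces to its first term, so the evaluation holds at all natural numbers.  At other points
  uniqueness is obtained as in the Bohr--Mollerup theorem: for \<open>y\<close> in \<open>[N, N + 1]\<close> the terms with
  \<open>k \<le> N\<close> are monotone in \<open>y\<close> and the later ones form an alternating tail of bounded size, so the
  series at \<open>y\<close> lies between its values at \<open>N\<close> and \<open>N + 1\<close> up to a bounded error
  (\<open>sum_between_integer_values\<close>).  Since \<open>\<Phi>\<close> grows like the square root, shifting \<open>y\<close> by integers
  towards infinity leaves no freedom.

  Differentiating term by term is justified where convergence is fast, at \<open>y = 3/2\<close>.  For \<open>n = 0\<close>
  the differentiated series converges only conditionally, so that majorants are of no use.
  The derivative of the telescoping identity connects the differentiated series at \<open>y\<close> and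
  \<open>y + 1\<close>, and its boundary terms vanish at all points \<open>n - 1/2\<close>; so the result passes from \<open>3/2\<close>
  to all of them (\<open>deriv_sums_half_integer\<close>).
\<close>

section \<open>The well-poised series and its closed form\<close>

definition wallis_ratio :: "nat \<Rightarrow> real" where
  "wallis_ratio k = pochhammer (1 / 2) k / fact k"

definition series_weight :: "nat \<Rightarrow> real" where
  "series_weight k = (4 * real k + 1) * wallis_ratio k ^ 2"

text \<open>
  With \<open>c = - y\<close> this is \<open>(-1)\<^sup>k (c)\<^sub>k / (3/2 - c)\<^sub>k\<close>, the part of the \<open>k\<close>-th term that depends on
  the parameter.  In this form it is visibly nonnegative while \<open>k \<le> y + 1\<close> and alternating afterwards.
\<close>
definition poch_quotient :: "nat \<Rightarrow> real \<Rightarrow> real" where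
  "poch_quotient k y = (\<Prod>j<k. (y - real j) / (y + 3 / 2 + real j))"

definition Gamma_quotient :: "real \<Rightarrow> real" where
  "Gamma_quotient y = Gamma (y + 3 / 2) / (Gamma (3 / 2) * Gamma (y + 1))"

lemma wallis_ratio_0 [simp]: "wallis_ratio 0 = 1"
  by (simp add: wallis_ratio_def)

lemma wallis_ratio_Suc:
  "wallis_ratio (Suc k) = wallis_ratio k * ((real k + 1 / 2) / (real k + 1))"
  by (simp add: wallis_ratio_def pochhammer_Suc field_simps)

lemma wallis_ratio_pos: "wallis_ratio k > 0"
  by (simp add: wallis_ratio_def pochhammer_pos)

text \<open>
  The crude bound is chosen because it survives the induction step:
  \<open>(2 k + 1) (2 k + 3) \<le> (2 k + 2)\<^sup>2\<close>.
\<close>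
lemma wallis_ratio_sq_le: "wallis_ratio k ^ 2 \<le> 1 / (2 * real k + 1)"
proof (induction k)
  case (Suc k)
  have "wallis_ratio (Suc k) ^ 2 = wallis_ratio k ^ 2 * ((real k + 1 / 2) / (real k + 1)) ^ 2"
    by (simp only: wallis_ratio_Suc power_mult_distrib)
  also have "\<dots> \<le> 1 / (2 * real k + 1) * ((real k + 1 / 2) / (real k + 1)) ^ 2"
    by (intro mult_right_mono Suc.IH) simp
  also have "\<dots> \<le> 1 / (2 * real (Suc k) + 1)"
    by (simp add: divide_simps power2_eq_square) (simp add: algebra_simps)
  finally show ?case .
qed simp

lemma series_weight_ge_1: "series_weight k \<ge> 1"
proof (induction k)
  case (Suc k)
  have "1 \<le> series_weight k" by fact
  also have "\<dots> \<le> series_weight k * ((4 * real k + 5) / (4 * real k + 1)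
                     * ((real k + 1 / 2) / (real k + 1)) ^ 2)"
  proof -
    have "1 \<le> (4 * real k + 5) / (4 * real k + 1) * ((real k + 1 / 2) / (real k + 1)) ^ 2"
      by (simp add: divide_simps power2_eq_square) (simp add: algebra_simps)
    then show ?thesis
      using Suc.IH by (intro mult_left_mono[of 1 _ "series_weight k", simplified mult_1_right]) simp_all
  qed
  also have "\<dots> = series_weight (Suc k)"
    by (simp add: series_weight_def wallis_ratio_Suc power_mult_distrib divide_simps)
  finally show ?case .
qed (simp add: series_weight_def)

lemma series_weight_le_2: "series_weight k \<le> 2"
proof -
  have "series_weight k \<le> (4 * real k + 1) * (1 / (2 * real k + 1))"
    unfolding series_weight_def by (intro mult_left_mono wallis_ratio_sq_le) simp
  also have "\<dots> \<le> 2"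
    by (simp add: divide_simps)
  finally show ?thesis .
qed

lemma poch_quotient_0 [simp]: "poch_quotient 0 y = 1"
  by (simp add: poch_quotient_def)

lemma poch_quotient_Suc:
  "poch_quotient (Suc k) y = poch_quotient k y * ((y - real k) / (y + 3 / 2 + real k))"
  by (simp add: poch_quotient_def)

text \<open>
  The ratio of the \<open>k\<close>-th factors at \<open>y + 1\<close> and at \<open>y\<close> telescopes.  It is stated without division
  because \<open>y + 1 - k\<close> may vanish.
\<close>
lemma poch_quotient_shift:
  assumes "y > -1"
  shows "poch_quotient k (y + 1) * ((y + 1 - real k) * (y + 3 / 2 + real k))
           = poch_quotient k y * ((y + 1) * (y + 3 / 2))"
proof (induction k)
  case (Suc k)
  have nz: "y + 3 / 2 + real k \<noteq> 0" "y + 5 / 2 + real k \<noteq> 0"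
    using assms by linarith+
  have "poch_quotient (Suc k) (y + 1) * ((y + 1 - real (Suc k)) * (y + 3 / 2 + real (Suc k)))
      = poch_quotient k (y + 1) * (y + 1 - real k) * (y - real k)"
    using nz by (simp add: poch_quotient_Suc field_simps)
  also have "\<dots> = poch_quotient k (y + 1) * ((y + 1 - real k) * (y + 3 / 2 + real k))
                    * ((y - real k) / (y + 3 / 2 + real k))"
    using nz by (simp add: field_simps)
  also have "\<dots> = poch_quotient (Suc k) y * ((y + 1) * (y + 3 / 2))"
    by (subst Suc.IH) (simp add: poch_quotient_Suc)
  finally show ?case .
qed simp

section \<open>Telescoping between neighbouring parameters\<close>

text \<open>
  The Wilf--Zeilberger certificate of the series: times \<open>poch_quotient K y\<close>, it is the amount by
  which the partial sums up to \<open>K\<close> fail to satisfy the recurrence of the Gamma quotient.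
\<close>
definition telescoping_error :: "nat \<Rightarrow> real \<Rightarrow> real" where
  "telescoping_error K y =
     (2 * y + 3) * (real K + 1 / 2) ^ 2 * wallis_ratio K ^ 2 / (y + real K + 3 / 2)"

text \<open>
  The Gamma quotient satisfies \<open>(y + 1) \<Phi>(y + 1) = (y + 3/2) \<Phi>(y)\<close>.  The partial sums of the
  series satisfy the same recurrence up to one boundary term; the induction step is a rational
  identity in \<open>y\<close> and \<open>K\<close>.
\<close>
lemma telescoping:
  assumes y: "y > -1"
  shows "(y + 1) * (\<Sum>k\<le>K. series_weight k * poch_quotient k (y + 1))
       = (y + 3 / 2) * (\<Sum>k\<le>K. series_weight k * poch_quotient k y)
         - telescoping_error K y * poch_quotient K y"
proof (induction K)
  case 0
  show ?case
    using y by (simp add: series_weight_def telescoping_error_def divide_simps power2_eq_square)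
      (simp add: algebra_simps)
next
  case (Suc K)
  have nz: "y + 3 / 2 + real K \<noteq> 0" "y + 5 / 2 + real K \<noteq> 0" "real K + 1 \<noteq> 0" "y + 1 \<noteq> 0"
    using y by linarith+
  \<comment> \<open>All three Pochhammer quotients in the step are rational multiples of \<open>q\<close>.\<close>
  define q where "q = poch_quotient K y / (y + 3 / 2 + real K)"
  have q: "poch_quotient K y = q * (y + 3 / 2 + real K)"
          "poch_quotient (Suc K) y = q * (y - real K)"
    using nz by (simp_all add: q_def poch_quotient_Suc)
  have "poch_quotient (Suc K) (y + 1) = poch_quotient K (y + 1) * (y + 1 - real K) / (y + 5 / 2 + real K)"
    by (simp add: poch_quotient_Suc algebra_simps)
  also have "poch_quotient K (y + 1) * (y + 1 - real K) = q * ((y + 1) * (y + 3 / 2))"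
    using poch_quotient_shift[OF y, of K] nz by (simp add: q_def field_simps)
  finally have q': "poch_quotient (Suc K) (y + 1) = q * ((y + 1) * (y + 3 / 2)) / (y + 5 / 2 + real K)" .
  define w where "w = wallis_ratio K ^ 2 / (real K + 1) ^ 2"
  have w: "wallis_ratio K ^ 2 = w * (real K + 1) ^ 2"
          "wallis_ratio (Suc K) ^ 2 = w * (real K + 1 / 2) ^ 2"
    using nz by (simp_all add: w_def wallis_ratio_Suc power_mult_distrib power_divide)
  have "(y + 1) * (series_weight (Suc K) * poch_quotient (Suc K) (y + 1))
      - (y + 3 / 2) * (series_weight (Suc K) * poch_quotient (Suc K) y)
      = telescoping_error K y * poch_quotient K y
      - telescoping_error (Suc K) y * poch_quotient (Suc K) y"
  proof -
    have e1: "telescoping_error K y * poch_quotient K y = 2 * (y + 3 / 2) * (real K + 1 / 2) ^ 2 * (w * (real K + 1) ^ 2) * q"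
      using nz unfolding telescoping_error_def q w by (simp add: field_simps)
    have e2: "telescoping_error (Suc K) y * poch_quotient (Suc K) y
       = 2 * (y + 3 / 2) * (real K + 3 / 2) ^ 2 * (w * (real K + 1 / 2) ^ 2) * (q * (y - real K)) / (y + 5 / 2 + real K)"
      unfolding telescoping_error_def q w by (simp add: algebra_simps add_divide_distrib diff_divide_distrib)
    show ?thesis
      unfolding e1 e2 unfolding q q' series_weight_def w using nz
      by (simp add: divide_simps power2_eq_square) algebra
  qed
  then show ?case
    using Suc.IH by (simp add: algebra_simps)
qed

lemma telescoping_error_bounds:
  assumes "y > -1"
  shows "0 \<le> telescoping_error K y" "telescoping_error K y \<le> (2 * y + 3) / 2"
proof -
  have pos: "2 * y + 3 > 0" "y + real K + 3 / 2 > 0"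
    using assms by linarith+
  show "0 \<le> telescoping_error K y"
    using pos unfolding telescoping_error_def by (intro divide_nonneg_pos mult_nonneg_nonneg) simp_all
  have "telescoping_error K y
      \<le> (2 * y + 3) * (real K + 1 / 2) ^ 2 * (1 / (2 * real K + 1)) / (y + real K + 3 / 2)"
    unfolding telescoping_error_def using pos
    by (intro divide_right_mono mult_left_mono wallis_ratio_sq_le) simp_all
  also have "\<dots> = (2 * y + 3) / 2 * ((real K + 1 / 2) / (y + real K + 3 / 2))"
  proof -
    have "(real K + 1 / 2) ^ 2 * (1 / (2 * real K + 1)) = (real K + 1 / 2) / 2"
      by (simp add: divide_simps power2_eq_square)
    then show ?thesis
      by (metis (no_types, lifting) mult.assoc times_divide_eq_right times_divide_eq_left)
  qed
  also have "\<dots> \<le> (2 * y + 3) / 2 * 1"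
    using pos assms by (intro mult_left_mono) (simp_all add: divide_simps)
  finally show "telescoping_error K y \<le> (2 * y + 3) / 2"
    by simp
qed

text \<open>
  The weights stay above 1, so convergence of any of the series below already forces the
  boundary terms of the telescoping to vanish.
\<close>
lemma tendsto_0_if_weighted_summable:
  assumes "summable (\<lambda>k. series_weight k * X k)"
  shows "X \<longlonglongrightarrow> 0"
proof (rule Lim_null_comparison)
  show "(\<lambda>k. \<bar>series_weight k * X k\<bar>) \<longlonglongrightarrow> 0"
    using summable_LIMSEQ_zero[OF assms] by (rule tendsto_rabs_zero)
  show "\<forall>\<^sub>F k in sequentially. norm (X k) \<le> \<bar>series_weight k * X k\<bar>"
  proof (rule always_eventually, rule allI)
    fix k
    have "1 * \<bar>X k\<bar> \<le> \<bar>series_weight k\<bar> * \<bar>X k\<bar>"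
      using series_weight_ge_1[of k] by (intro mult_right_mono) auto
    then show "norm (X k) \<le> \<bar>series_weight k * X k\<bar>"
      by (simp add: abs_mult)
  qed
qed

lemma telescoping_error_tendsto_0:
  assumes "y > -1" "X \<longlonglongrightarrow> 0"
  shows "(\<lambda>K. telescoping_error K y * X K) \<longlonglongrightarrow> 0"
proof (rule Lim_null_comparison)
  show "(\<lambda>K. (2 * y + 3) / 2 * \<bar>X K\<bar>) \<longlonglongrightarrow> 0"
    using assms(2) by (intro tendsto_mult_right_zero tendsto_rabs_zero)
  show "\<forall>\<^sub>F K in sequentially. norm (telescoping_error K y * X K) \<le> (2 * y + 3) / 2 * \<bar>X K\<bar>"
    using telescoping_error_bounds[OF assms(1)]
    by (intro always_eventually allI)
      (simp only: real_norm_def abs_mult abs_of_nonneg mult_right_mono abs_ge_zero)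
qed

lemma sums_step:
  assumes y: "y > -1" and s: "(\<lambda>k. series_weight k * poch_quotient k y) sums s"
  shows "(\<lambda>k. series_weight k * poch_quotient k (y + 1)) sums ((y + 3 / 2) / (y + 1) * s)"
proof -
  have "(\<lambda>K. ((y + 3 / 2) * (\<Sum>k\<le>K. series_weight k * poch_quotient k y)
          - telescoping_error K y * poch_quotient K y) / (y + 1)) \<longlonglongrightarrow> ((y + 3 / 2) * s - 0) / (y + 1)"
    using s y unfolding sums_def_le
    by (intro tendsto_intros telescoping_error_tendsto_0 tendsto_0_if_weighted_summable
          sums_summable[OF s]) auto
  also have "(\<lambda>K. ((y + 3 / 2) * (\<Sum>k\<le>K. series_weight k * poch_quotient k y)
          - telescoping_error K y * poch_quotient K y) / (y + 1))
      = (\<lambda>K. \<Sum>k\<le>K. series_weight k * poch_quotient k (y + 1))"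
    using telescoping[OF y] y by (simp add: fun_eq_iff field_simps)
  finally show ?thesis
    unfolding sums_def_le by simp
qed

lemma Gamma_quotient_pos: "y > -1 \<Longrightarrow> Gamma_quotient y > 0"
  unfolding Gamma_quotient_def by (intro divide_pos_pos mult_pos_pos Gamma_real_pos) simp_all

lemma Gamma_quotient_step:
  assumes "y > -1"
  shows "Gamma_quotient (y + 1) = (y + 3 / 2) / (y + 1) * Gamma_quotient y"
proof -
  have "Gamma (y + 3 / 2 + 1) = (y + 3 / 2) * Gamma (y + 3 / 2)" "Gamma (y + 1 + 1) = (y + 1) * Gamma (y + 1)"
    using assms by (intro Gamma_plus1; auto elim!: nonpos_Ints_cases)+
  then show ?thesis
    by (simp add: Gamma_quotient_def add_ac)
qed

lemma sums_steps:
  assumes y: "y > -1" and s: "(\<lambda>k. series_weight k * poch_quotient k y) sums (c * Gamma_quotient y)"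
  shows "(\<lambda>k. series_weight k * poch_quotient k (y + real m)) sums (c * Gamma_quotient (y + real m))"
proof (induction m)
  case (Suc m)
  have "(\<lambda>k. series_weight k * poch_quotient k (y + real m + 1))
     sums ((y + real m + 3 / 2) / (y + real m + 1) * (c * Gamma_quotient (y + real m)))"
    using y by (intro sums_step Suc.IH) simp
  also have "(y + real m + 3 / 2) / (y + real m + 1) * (c * Gamma_quotient (y + real m))
     = c * Gamma_quotient (y + real m + 1)"
    using y by (subst Gamma_quotient_step) simp_all
  finally show ?case by (simp add: add_ac)
qed (use s in simp)

text \<open>
  The limit does not depend on \<open>x\<close>, so \<open>\<Phi>\<close> takes asymptotically equal values throughout a
  unit interval \<open>[N, N + 1]\<close>.  The proof divides two instances of Euler's limit formula for \<open>\<Gamma>\<close>.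
\<close>
lemma Gamma_quotient_asymptotics:
  assumes x: "x > -1"
  shows "(\<lambda>n. Gamma_quotient (x + real (Suc n)) / sqrt (real n)) \<longlonglongrightarrow> 1 / Gamma (3 / 2)"
proof -
  have G: "Gamma (x + 1) > 0" "Gamma (x + 3 / 2) > 0" "Gamma (3 / 2 :: real) > 0"
    using x by (intro Gamma_real_pos; simp)+
  \<comment> \<open>The recurrence, iterated, turns the claim into one about Pochhammer symbols.\<close>
  have eq: "Gamma_quotient (x + real m)
      = Gamma_quotient x * (pochhammer (x + 3 / 2) m / pochhammer (x + 1) m)" for m
  proof (induction m)
    case (Suc m)
    have "Gamma_quotient (x + real m + 1)
        = (x + real m + 3 / 2) / (x + real m + 1) * Gamma_quotient (x + real m)"
      using x by (intro Gamma_quotient_step) simp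
    then show ?case
      by (simp add: Suc.IH pochhammer_Suc add_ac mult_ac)
  qed simp
  have "(\<lambda>n. Gamma_quotient x * (Gamma_series (x + 1) n / Gamma_series (x + 3 / 2) n))
      \<longlonglongrightarrow> Gamma_quotient x * (Gamma (x + 1) / Gamma (x + 3 / 2))"
    using G by (intro tendsto_intros Gamma_series_LIMSEQ) auto
  moreover have "Gamma_quotient x * (Gamma (x + 1) / Gamma (x + 3 / 2)) = 1 / Gamma (3 / 2)"
    using G by (simp add: Gamma_quotient_def)
  moreover have "\<forall>\<^sub>F n in sequentially.
      Gamma_quotient x * (Gamma_series (x + 1) n / Gamma_series (x + 3 / 2) n)
      = Gamma_quotient (x + real (Suc n)) / sqrt (real n)"
  proof (rule eventually_sequentiallyI[of 1])
    fix n :: nat assume n: "n \<ge> 1"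
    have "exp ((x + 3 / 2) * ln (real n)) = exp ((x + 1) * ln (real n)) * exp (ln (sqrt (real n)))"
      using n by (simp add: ln_sqrt exp_add[symmetric] algebra_simps)
    also have "exp (ln (sqrt (real n))) = sqrt (real n)"
      using n by simp
    finally have e: "exp ((x + 3 / 2) * ln (real n)) = exp ((x + 1) * ln (real n)) * sqrt (real n)" .
    have p: "pochhammer (x + 1) (Suc n) > 0" "pochhammer (x + 3 / 2) (Suc n) > 0"
      using x by (intro pochhammer_pos; simp)+
    show "Gamma_quotient x * (Gamma_series (x + 1) n / Gamma_series (x + 3 / 2) n)
      = Gamma_quotient (x + real (Suc n)) / sqrt (real n)"
      unfolding eq Gamma_series_def using p n e by (simp add: field_simps)
  qed
  ultimately show ?thesis
    using Lim_transform_eventually by fastforce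
qed

lemma poch_quotient_eq_0: "n < k \<Longrightarrow> poch_quotient k (real n) = 0"
  unfolding poch_quotient_def by (subst prod_zero_iff) auto

text \<open>
  At a nonnegative integer the series terminates, and at 0 only the term \<open>k = 0\<close> survives.
  The recurrence then carries the evaluation to all integers.
\<close>
lemma sums_at_nat:
  "(\<lambda>k. series_weight k * poch_quotient k (real n)) sums Gamma_quotient (real n)"
proof -
  have "(\<lambda>k. series_weight k * poch_quotient k 0) sums (\<Sum>k\<in>{0}. series_weight k * poch_quotient k 0)"
    using poch_quotient_eq_0[of 0] by (intro sums_finite) auto
  then have "(\<lambda>k. series_weight k * poch_quotient k 0) sums (1 * Gamma_quotient 0)"
    using Gamma_real_pos[of "3 / 2"] by (simp add: series_weight_def Gamma_quotient_def less_imp_neq[symmetric])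
  from sums_steps[OF _ this, of n] show ?thesis by simp
qed

lemma sum_at_nat: "(\<Sum>k\<le>n. series_weight k * poch_quotient k (real n)) = Gamma_quotient (real n)"
proof -
  have "(\<lambda>k. series_weight k * poch_quotient k (real n))
          sums (\<Sum>k\<le>n. series_weight k * poch_quotient k (real n))"
    using poch_quotient_eq_0[of n] by (intro sums_finite) auto
  then show ?thesis
    using sums_at_nat sums_unique2 by blast
qed

section \<open>Evaluation of the series between the integers\<close>

lemma poch_quotient_bounds:
  assumes "real k \<le> y + 1" "y \<ge> -1"
  shows "0 \<le> poch_quotient k y" "poch_quotient k y \<le> 1"
proof -
  have *: "0 \<le> (y - real j) / (y + 3 / 2 + real j) \<and> (y - real j) / (y + 3 / 2 + real j) \<le> 1"
    if "j < k" for j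
  proof -
    have "real j + 1 \<le> real k" using that by linarith
    then show ?thesis using assms by (auto simp: divide_simps)
  qed
  show "0 \<le> poch_quotient k y" "poch_quotient k y \<le> 1"
    unfolding poch_quotient_def using * by (auto intro!: prod_nonneg prod_le_1)
qed

lemma poch_quotient_mono:
  assumes "real k \<le> y + 1" "-1 \<le> y" "y \<le> z"
  shows "poch_quotient k y \<le> poch_quotient k z"
  unfolding poch_quotient_def
proof (rule prod_mono)
  fix j assume "j \<in> {..<k}"
  then have j: "real j + 1 \<le> real k" by simp
  have p: "y + 3 / 2 + real j > 0" "z + 3 / 2 + real j > 0" using assms by linarith+
  have "(y - real j) * (z + 3 / 2 + real j) \<le> (z - real j) * (y + 3 / 2 + real j)"
  proof -
    have "(z - real j) * (y + 3 / 2 + real j) - (y - real j) * (z + 3 / 2 + real j)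
        = (z - y) * (2 * real j + 3 / 2)" by (simp add: field_simps)
    also have "\<dots> \<ge> 0" using assms by simp
    finally show ?thesis by simp
  qed
  then have "(y - real j) / (y + 3 / 2 + real j) \<le> (z - real j) / (z + 3 / 2 + real j)"
    by (simp only: pos_divide_le_eq[OF p(1)] pos_le_divide_eq[OF p(2)] times_divide_eq_left)
  then show "0 \<le> (y - real j) / (y + 3 / 2 + real j) \<and>
      (y - real j) / (y + 3 / 2 + real j) \<le> (z - real j) / (z + 3 / 2 + real j)"
    using j assms p by (intro conjI divide_nonneg_pos) linarith+
qed

text \<open>
  As \<open>y\<close> lies in \<open>[M - 1, M]\<close>, the factors with index below \<open>M\<close> are nonnegative, the others nonpositive.
\<close>
lemma poch_quotient_sign:
  assumes y: "y \<ge> -1" "real M \<le> y + 1" "y \<le> real M"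
  shows "poch_quotient (M + i) y = (-1) ^ i * \<bar>poch_quotient (M + i) y\<bar>"
proof (induction i)
  case 0
  then show ?case using poch_quotient_bounds[of M y] y by simp
next
  case (Suc i)
  have p: "y + 3 / 2 + real (M + i) > 0" using y by linarith
  have "(y - real (M + i)) / (y + 3 / 2 + real (M + i)) = - \<bar>(y - real (M + i)) / (y + 3 / 2 + real (M + i))\<bar>"
    using p y by (simp add: divide_simps)
  then have "poch_quotient (M + Suc i) y = ((-1) ^ i * \<bar>poch_quotient (M + i) y\<bar>)
      * - \<bar>(y - real (M + i)) / (y + 3 / 2 + real (M + i))\<bar>"
    using Suc.IH by (simp only: add_Suc_right poch_quotient_Suc)
  also have "\<dots> = (-1) ^ Suc i * \<bar>poch_quotient (M + Suc i) y\<bar>"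
    by (simp only: add_Suc_right poch_quotient_Suc abs_mult) simp
  finally show ?case .
qed

text \<open>
  The weights increase, by a factor \<open>1 + O(1/k^3)\<close>; the ratio \<open>(k + 1/2) / (k + 1)\<close> that comes with
  the next factor of the Pochhammer quotient more than compensates for this.
\<close>
lemma weight_ratio_bound: "series_weight (Suc k) * (real k + 1 / 2) \<le> series_weight k * (real k + 1)"
proof -
  have "(4 * real k + 1) * (real k + 1) ^ 3 - (4 * real k + 5) * (real k + 1 / 2) ^ 3
      = 2 * real k ^ 3 + 9 / 2 * real k ^ 2 + 11 / 4 * real k + 3 / 8"
    by (simp add: power3_eq_cube power2_eq_square field_simps)
  also have "\<dots> \<ge> 0" by simp
  finally have le: "(4 * real k + 5) * (real k + 1 / 2) ^ 3 \<le> (4 * real k + 1) * (real k + 1) ^ 3"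
    by simp
  define w where "w = wallis_ratio k ^ 2 / (real k + 1) ^ 2"
  have w: "wallis_ratio k ^ 2 = w * (real k + 1) ^ 2"
          "wallis_ratio (Suc k) ^ 2 = w * (real k + 1 / 2) ^ 2"
    by (simp_all add: w_def wallis_ratio_Suc power_mult_distrib power_divide)
  have "series_weight (Suc k) * (real k + 1 / 2) = w * ((4 * real k + 5) * (real k + 1 / 2) ^ 3)"
    unfolding series_weight_def w by (simp add: power2_eq_square power3_eq_cube)
  also have "\<dots> \<le> w * ((4 * real k + 1) * (real k + 1) ^ 3)"
    using le by (intro mult_left_mono) (simp_all add: w_def)
  also have "\<dots> = series_weight k * (real k + 1)"
    unfolding series_weight_def w by (simp add: power2_eq_square power3_eq_cube)
  finally show ?thesis .
qed

lemma term_decreasing: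
  assumes "y \<ge> -1 / 2" "y \<le> real k"
  shows "\<bar>series_weight (Suc k) * poch_quotient (Suc k) y\<bar> \<le> \<bar>series_weight k * poch_quotient k y\<bar>"
proof -
  have p: "y + 3 / 2 + real k \<ge> real k + 1" using assms by linarith
  have "\<bar>y - real k\<bar> / \<bar>y + 3 / 2 + real k\<bar> \<le> (real k + 1 / 2) / (real k + 1)"
    using assms p by (intro frac_le) auto
  then have "\<bar>series_weight (Suc k) * poch_quotient (Suc k) y\<bar>
     \<le> series_weight (Suc k) * (\<bar>poch_quotient k y\<bar> * ((real k + 1 / 2) / (real k + 1)))"
    using series_weight_ge_1[of "Suc k"] unfolding poch_quotient_Suc abs_mult abs_divide
    by (subst abs_of_nonneg[of "series_weight (Suc k)"]) (auto intro!: mult_left_mono simp del: times_divide_eq_right)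
  also have "\<dots> = series_weight (Suc k) * (real k + 1 / 2) / (real k + 1) * \<bar>poch_quotient k y\<bar>"
    by simp
  also have "\<dots> \<le> series_weight k * \<bar>poch_quotient k y\<bar>"
    using weight_ratio_bound[of k] by (intro mult_right_mono mult_imp_div_pos_le) simp_all
  finally show ?thesis using series_weight_ge_1[of k] by (simp add: abs_mult)
qed

text \<open>
  Beyond \<open>M\<close> the terms alternate and decrease in absolute value, so Leibniz' criterion gives
  convergence and bounds the tail by its first term, which is at most 2 for every \<open>y\<close>.
\<close>
lemma alternating_tail:
  assumes y: "y \<ge> -1 / 2" "real M \<le> y + 1" "y \<le> real M"
    and lim: "(\<lambda>k. poch_quotient k y) \<longlonglongrightarrow> 0"
  shows "\<exists>t. (\<lambda>k. series_weight k * poch_quotient k y) sums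
           ((\<Sum>k<M. series_weight k * poch_quotient k y) + t) \<and> 0 \<le> t \<and> t \<le> 2"
proof -
  define a where "a i = \<bar>series_weight (M + i) * poch_quotient (M + i) y\<bar>" for i
  have "(\<lambda>k. 2 * \<bar>poch_quotient (k + M) y\<bar>) \<longlonglongrightarrow> 0"
    using lim by (intro tendsto_mult_right_zero tendsto_rabs_zero) (rule LIMSEQ_ignore_initial_segment)
  moreover have "\<forall>\<^sub>F i in sequentially. norm (a i) \<le> 2 * \<bar>poch_quotient (i + M) y\<bar>"
  proof (rule always_eventually, rule allI)
    fix i
    show "norm (a i) \<le> 2 * \<bar>poch_quotient (i + M) y\<bar>"
      using mult_right_mono[OF series_weight_le_2[of "i + M"], of "\<bar>poch_quotient (i + M) y\<bar>"]
        series_weight_ge_1[of "i + M"]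
      by (simp add: a_def abs_mult add.commute)
  qed
  ultimately have a0: "a \<longlonglongrightarrow> 0"
    by (rule Lim_null_comparison[rotated])
  have a1: "a (Suc n) \<le> a n" for n
    unfolding a_def add_Suc_right using y by (intro term_decreasing) auto
  have a2: "0 \<le> a n" for n
    by (simp add: a_def)
  note L = summable_Leibniz'(1)[of a, OF a0 a2 a1] summable_Leibniz'(2)[of a 0, OF a0 a2 a1]
    summable_Leibniz'(4)[of a 0, OF a0 a2 a1]
  have "series_weight (i + M) * poch_quotient (i + M) y = (-1) ^ i * a i" for i
    using poch_quotient_sign[of y M i] y series_weight_ge_1[of "M + i"]
    by (simp only: a_def abs_mult add.commute[of i]) (simp add: mult_ac)
  then have "(\<lambda>i. series_weight (i + M) * poch_quotient (i + M) y) sums (\<Sum>i. (-1) ^ i * a i)"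
    using summable_sums[OF L(1)] by simp
  then have "(\<lambda>k. series_weight k * poch_quotient k y) sums
           ((\<Sum>k<M. series_weight k * poch_quotient k y) + (\<Sum>i. (-1) ^ i * a i))"
    by (subst (asm) sums_iff_shift) (simp only: add.commute)
  moreover have "a 0 \<le> 2 * 1"
    using series_weight_le_2[of M] series_weight_ge_1[of M] poch_quotient_bounds[of M y] y
    unfolding a_def abs_mult by (intro mult_mono) auto
  ultimately show ?thesis
    using L by (intro exI[of _ "\<Sum>i. (-1) ^ i * a i"]) simp
qed

text \<open>
  On this range of \<open>y\<close> every factor is bounded by the corresponding factor of the Wallis ratio.
\<close>
lemma abs_poch_quotient_le_wallis_ratio:
  assumes "-1 / 2 \<le> y" "y \<le> 1"
  shows "\<bar>poch_quotient k y\<bar> \<le> wallis_ratio k"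
proof (induction k)
  case (Suc k)
  have "\<bar>y - real k\<bar> / \<bar>y + 3 / 2 + real k\<bar> \<le> (real k + 1 / 2) / (real k + 1)"
  proof (cases "k = 0")
    case True
    then show ?thesis using assms by (simp add: divide_simps)
  next
    case False
    then have "real k \<ge> 1" by simp
    then have "\<bar>y - real k\<bar> \<le> real k + 1 / 2" "\<bar>y + 3 / 2 + real k\<bar> \<ge> real k + 1"
      using assms by linarith+
    then show ?thesis by (intro frac_le) auto
  qed
  then show ?case
    unfolding poch_quotient_Suc wallis_ratio_Suc abs_mult abs_divide
    using Suc.IH wallis_ratio_pos[of k] by (intro mult_mono) auto
qed simp

text \<open>
  The Wallis ratio decays like \<open>1 / sqrt k\<close>, faster than the harmonic numbers grow.
\<close>
lemma harm_wallis_ratio_tendsto_0: "(\<lambda>k. harm k * wallis_ratio k) \<longlonglongrightarrow> 0"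
proof -
  have s: "(\<lambda>k. inverse (sqrt (real k))) \<longlonglongrightarrow> 0"
    by (intro tendsto_inverse_0_at_top filterlim_compose[OF sqrt_at_top] filterlim_real_sequentially)
  have "(\<lambda>k. (harm k - ln (real k)) * inverse (sqrt (real k)) + ln (real k) / real k powr (1 / 2))
     \<longlonglongrightarrow> euler_mascheroni * 0 + 0"
    by (intro tendsto_intros s euler_mascheroni_LIMSEQ lim_ln_over_power) simp
  moreover have "(harm k - ln (real k)) * inverse (sqrt (real k)) + ln (real k) / real k powr (1 / 2)
      = harm k * inverse (sqrt (real k))" for k
    unfolding powr_half_sqrt[OF of_nat_0_le_iff] by (simp add: divide_inverse left_diff_distrib)
  ultimately have "(\<lambda>k. harm k * inverse (sqrt (real k))) \<longlonglongrightarrow> 0"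
    by simp
  moreover have "\<forall>\<^sub>F k in sequentially. norm (harm k * wallis_ratio k) \<le> harm k * inverse (sqrt (real k))"
  proof (rule eventually_sequentiallyI[of 1])
    fix k :: nat assume k: "k \<ge> 1"
    have "wallis_ratio k ^ 2 \<le> 1 / real k"
      using k by (intro order.trans[OF wallis_ratio_sq_le[of k]]) (simp add: divide_simps)
    then have "wallis_ratio k \<le> sqrt (1 / real k)"
      by (rule real_le_rsqrt)
    then show "norm (harm k * wallis_ratio k) \<le> harm k * inverse (sqrt (real k))"
      using wallis_ratio_pos[of k] harm_nonneg[of k, where ?'a = real]
      by (auto simp: abs_mult real_sqrt_inverse divide_inverse intro!: mult_left_mono)
  qed
  ultimately show ?thesis
    by (rule Lim_null_comparison[rotated])
qed

lemma wallis_ratio_tendsto_0: "wallis_ratio \<longlonglongrightarrow> 0"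
proof (rule Lim_null_comparison[OF _ harm_wallis_ratio_tendsto_0])
  show "\<forall>\<^sub>F k in sequentially. norm (wallis_ratio k) \<le> harm k * wallis_ratio k"
  proof (rule eventually_sequentiallyI[of 1])
    fix k :: nat assume "k \<ge> 1"
    then have "1 \<le> (harm k :: real)"
      using harm_mono[of 1 k, where ?'a = real] by (simp add: harm_expand)
    then show "norm (wallis_ratio k) \<le> harm k * wallis_ratio k"
      using wallis_ratio_pos[of k] by simp
  qed
qed

lemma poch_quotient_tendsto_0:
  assumes "-1 / 2 \<le> y" "y \<le> 1"
  shows "(\<lambda>k. poch_quotient k y) \<longlonglongrightarrow> 0"
  using wallis_ratio_tendsto_0 abs_poch_quotient_le_wallis_ratio[OF assms]
  by (intro Lim_null_comparison[where f = "\<lambda>k. poch_quotient k y" and g = wallis_ratio, OF always_eventually]) auto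

text \<open>
  The terms with \<open>k \<le> N\<close> increase with the parameter on \<open>[N, N + 1]\<close>, so their sum lies between the
  known values at \<open>N\<close> and \<open>N + 1\<close>.  The rest is a Leibniz tail of size at most 2, which is
  negligible since \<open>\<Phi>\<close> grows like a square root.
\<close>
lemma sum_between_integer_values:
  assumes \<theta>: "0 \<le> \<theta>" "\<theta> \<le> 1"
    and s: "(\<lambda>k. series_weight k * poch_quotient k (real N + \<theta>)) sums v"
  shows "Gamma_quotient (real N) \<le> v" "v \<le> Gamma_quotient (real (Suc N)) + 2"
proof -
  let ?y = "real N + \<theta>"
  have w: "series_weight k \<ge> 0" for k
    using series_weight_ge_1[of k] by linarith
  obtain t where "(\<lambda>k. series_weight k * poch_quotient k ?y) sums
           ((\<Sum>k<Suc N. series_weight k * poch_quotient k ?y) + t)" and t: "0 \<le> t" "t \<le> 2"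
    using alternating_tail[of ?y "Suc N"] \<theta> tendsto_0_if_weighted_summable[OF sums_summable[OF s]]
    by auto
  then have v: "v = (\<Sum>k<Suc N. series_weight k * poch_quotient k ?y) + t"
    using s sums_unique2 by blast
  have "Gamma_quotient (real N) = (\<Sum>k<Suc N. series_weight k * poch_quotient k (real N))"
    by (simp add: sum_at_nat[symmetric] lessThan_Suc_atMost)
  also have "\<dots> \<le> (\<Sum>k<Suc N. series_weight k * poch_quotient k ?y)"
    using \<theta> by (intro sum_mono mult_left_mono w poch_quotient_mono) auto
  finally show "Gamma_quotient (real N) \<le> v"
    using v t by simp
  have "(\<Sum>k<Suc N. series_weight k * poch_quotient k ?y)
      \<le> (\<Sum>k<Suc N. series_weight k * poch_quotient k (real (Suc N)))"
    using \<theta> by (intro sum_mono mult_left_mono w poch_quotient_mono) auto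
  also have "\<dots> \<le> (\<Sum>k\<le>Suc N. series_weight k * poch_quotient k (real (Suc N)))"
    by (intro sum_mono2 mult_nonneg_nonneg w poch_quotient_bounds) auto
  also have "\<dots> = Gamma_quotient (real (Suc N))"
    by (rule sum_at_nat)
  finally show "v \<le> Gamma_quotient (real (Suc N)) + 2"
    using v t by simp
qed

text \<open>
  The quotient \<open>c\<close> of the series by \<open>\<Phi>\<close> does not change when the parameter is shifted by 1, since both
  satisfy the same recurrence.  Far to the right the squeeze between integer values forces \<open>c = 1\<close>.
\<close>
lemma sums_unit_interval:
  assumes \<theta>: "0 \<le> \<theta>" "\<theta> \<le> 1"
  shows "(\<lambda>k. series_weight k * poch_quotient k \<theta>) sums Gamma_quotient \<theta>"
proof -
  obtain v where v: "(\<lambda>k. series_weight k * poch_quotient k \<theta>) sums v"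
    using alternating_tail[of \<theta> 1] poch_quotient_tendsto_0[of \<theta>] \<theta> by auto
  define c where "c = v / Gamma_quotient \<theta>"
  have pos: "Gamma_quotient \<theta> > 0" using \<theta> by (intro Gamma_quotient_pos) simp
  then have vc: "v = c * Gamma_quotient \<theta>" by (simp add: c_def)
  have s: "(\<lambda>k. series_weight k * poch_quotient k (real m + \<theta>)) sums (c * Gamma_quotient (\<theta> + real m))" for m
    using sums_steps[of \<theta> c m] v \<theta> by (simp add: vc add.commute)
  define g where "g = 1 / Gamma (3 / 2 :: real)"
  have g: "g > 0" unfolding g_def by (intro divide_pos_pos Gamma_real_pos) simp_all
  have lim: "(\<lambda>n. c * (Gamma_quotient (\<theta> + real (Suc n)) / sqrt (real n))) \<longlonglongrightarrow> c * g"
    using \<theta> unfolding g_def by (intro tendsto_mult_left Gamma_quotient_asymptotics) simp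
  have lim0: "(\<lambda>n. Gamma_quotient (0 + real (Suc n)) / sqrt (real n)) \<longlonglongrightarrow> g"
    unfolding g_def by (intro Gamma_quotient_asymptotics) simp
  have "(\<lambda>k. 2 * inverse (sqrt (real k))) \<longlonglongrightarrow> 0"
    by (intro tendsto_mult_right_zero tendsto_inverse_0_at_top filterlim_compose[OF sqrt_at_top] filterlim_real_sequentially)
  then have lim1: "(\<lambda>n. Gamma_quotient (1 + real (Suc n)) / sqrt (real n) + 2 * inverse (sqrt (real n))) \<longlonglongrightarrow> g + 0"
    unfolding g_def by (intro tendsto_add Gamma_quotient_asymptotics) simp_all
  have "g \<le> c * g"
  proof (rule LIMSEQ_le[OF lim0 lim], intro exI[of _ 0] allI impI)
    fix n
    have "Gamma_quotient (0 + real (Suc n)) / sqrt (real n) \<le> c * Gamma_quotient (\<theta> + real (Suc n)) / sqrt (real n)"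
      using sum_between_integer_values(1)[OF \<theta> s, of "Suc n"] by (intro divide_right_mono) simp_all
    then show "Gamma_quotient (0 + real (Suc n)) / sqrt (real n) \<le> c * (Gamma_quotient (\<theta> + real (Suc n)) / sqrt (real n))"
      by simp
  qed
  moreover have "c * g \<le> g + 0"
  proof (rule LIMSEQ_le[OF lim lim1], intro exI[of _ 0] allI impI)
    fix n
    have "c * Gamma_quotient (\<theta> + real (Suc n)) / sqrt (real n) \<le> (Gamma_quotient (1 + real (Suc n)) + 2) / sqrt (real n)"
      using sum_between_integer_values(2)[OF \<theta> s, of "Suc n"] by (intro divide_right_mono) (simp_all add: add_ac)
    then show "c * (Gamma_quotient (\<theta> + real (Suc n)) / sqrt (real n))
        \<le> Gamma_quotient (1 + real (Suc n)) / sqrt (real n) + 2 * inverse (sqrt (real n))"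
      by (simp add: add_divide_distrib divide_inverse algebra_simps)
  qed
  ultimately have "c = 1" using g by simp
  then show ?thesis using v vc by simp
qed

text \<open>
  This is the summation formula for the very-well-poised hypergeometric series 4F3 at
  the point -1, with two of its upper parameters equal to \<open>1/2\<close> and another equal to \<open>-y\<close>.
\<close>
theorem sums_Gamma_quotient:
  assumes "y \<ge> 0"
  shows "(\<lambda>k. series_weight k * poch_quotient k y) sums Gamma_quotient y"
proof -
  have "(\<lambda>k. series_weight k * poch_quotient k (frac y)) sums (1 * Gamma_quotient (frac y))"
    using sums_unit_interval[of "frac y"] frac_lt_1[of y] by simp
  from sums_steps[OF _ this, of "nat \<lfloor>y\<rfloor>"] show ?thesis
    using assms by (simp add: frac_def) (smt (verit) frac_def frac_ge_0)
qed

text \<open>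
  The parameter \<open>-1/2\<close> belongs to \<open>n = 0\<close>.  Convergence holds there by Leibniz' criterion, and
  the value is read off from the recurrence, used backwards from \<open>1/2\<close>.
\<close>
lemma sums_Gamma_quotient_minus_half:
  "(\<lambda>k. series_weight k * poch_quotient k (-1 / 2)) sums Gamma_quotient (-1 / 2)"
proof -
  obtain v where v: "(\<lambda>k. series_weight k * poch_quotient k (-1 / 2)) sums v"
    using alternating_tail[of "-1 / 2" 0] poch_quotient_tendsto_0[of "-1 / 2"] by auto
  have "(\<lambda>k. series_weight k * poch_quotient k (1 / 2)) sums (2 * v)"
    using sums_step[OF _ v] by simp
  then have "2 * v = Gamma_quotient (1 / 2)"
    using sums_Gamma_quotient[of "1 / 2"] sums_unique2 by fastforce
  also have "\<dots> = 2 * Gamma_quotient (-1 / 2)"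
    using Gamma_quotient_step[of "-1 / 2"] by simp
  finally show ?thesis using v by simp
qed

section \<open>Differentiated recurrences\<close>

definition poch_log_deriv :: "nat \<Rightarrow> real \<Rightarrow> real" where
  "poch_log_deriv k y = (\<Sum>j<k. 1 / (y - real j) - 1 / (y + 3 / 2 + real j))"

definition Gamma_quotient_deriv :: "real \<Rightarrow> real" where
  "Gamma_quotient_deriv y = Gamma_quotient y * (Digamma (y + 3 / 2) - Digamma (y + 1))"

lemma DERIV_poch_quotient:
  assumes "y > -1" "y \<notin> \<nat>"
  shows "(poch_quotient k has_field_derivative poch_quotient k y * poch_log_deriv k y) (at y)"
proof (induction k)
  case 0
  show ?case by (simp add: poch_log_deriv_def poch_quotient_def)
next
  case (Suc k)
  have nz: "y - real k \<noteq> 0" "y + 3 / 2 + real k \<noteq> 0"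
    using assms by auto
  have "((\<lambda>z. (z - real k) / (z + 3 / 2 + real k)) has_field_derivative
      ((y + 3 / 2 + real k) - (y - real k)) / (y + 3 / 2 + real k) ^ 2) (at y)"
    using nz by (auto intro!: derivative_eq_intros simp: power2_eq_square)
  from DERIV_mult'[OF Suc.IH this]
  have "((\<lambda>z. poch_quotient k z * ((z - real k) / (z + 3 / 2 + real k))) has_field_derivative
      poch_quotient k y * (((y + 3 / 2 + real k) - (y - real k)) / (y + 3 / 2 + real k) ^ 2)
      + poch_quotient k y * poch_log_deriv k y * ((y - real k) / (y + 3 / 2 + real k))) (at y)" .
  also have "poch_quotient k y * (((y + 3 / 2 + real k) - (y - real k)) / (y + 3 / 2 + real k) ^ 2)
     = poch_quotient k y * ((y - real k) / (y + 3 / 2 + real k))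
         * (1 / (y - real k) - 1 / (y + 3 / 2 + real k))"
  proof -
    have "p * ((b - a) / b ^ 2) = p * (a / b) * (1 / a - 1 / b)" if "a \<noteq> 0" "b \<noteq> 0" for a b p :: real
      using that by (simp add: field_simps power2_eq_square)
    from this[OF nz] show ?thesis .
  qed
  also have "poch_quotient k y * ((y - real k) / (y + 3 / 2 + real k))
         * (1 / (y - real k) - 1 / (y + 3 / 2 + real k))
      + poch_quotient k y * poch_log_deriv k y * ((y - real k) / (y + 3 / 2 + real k))
      = poch_quotient (Suc k) y * poch_log_deriv (Suc k) y"
    by (simp only: poch_quotient_Suc poch_log_deriv_def sum.lessThan_Suc distrib_left mult_ac add_ac)
  also have "(\<lambda>z. poch_quotient k z * ((z - real k) / (z + 3 / 2 + real k))) = poch_quotient (Suc k)"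
    by (rule ext) (simp only: poch_quotient_Suc)
  finally show ?case .
qed

lemma DERIV_Gamma_quotient:
  assumes "y > -1"
  shows "(Gamma_quotient has_field_derivative Gamma_quotient_deriv y) (at y)"
proof -
  have G: "Gamma (y + 1) > 0" "Gamma (3 / 2 :: real) > 0"
    using assms by (intro Gamma_real_pos; simp)+
  have n: "y + 3 / 2 \<notin> \<int>\<^sub>\<le>\<^sub>0" "y + 1 \<notin> \<int>\<^sub>\<le>\<^sub>0"
    using assms by (auto elim!: nonpos_Ints_cases)
  have "((\<lambda>z. Gamma (z + 3 / 2) / (Gamma (3 / 2) * Gamma (z + 1))) has_field_derivative
      ((Gamma (y + 3 / 2) * Digamma (y + 3 / 2)) * (Gamma (3 / 2) * Gamma (y + 1))
       - Gamma (y + 3 / 2) * (Gamma (3 / 2) * (Gamma (y + 1) * Digamma (y + 1))))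
       / ((Gamma (3 / 2) * Gamma (y + 1)) * (Gamma (3 / 2) * Gamma (y + 1)))) (at y)"
    using G n by (auto intro!: derivative_eq_intros simp: less_imp_neq[symmetric])
  also have "((Gamma (y + 3 / 2) * Digamma (y + 3 / 2)) * (Gamma (3 / 2) * Gamma (y + 1))
       - Gamma (y + 3 / 2) * (Gamma (3 / 2) * (Gamma (y + 1) * Digamma (y + 1))))
       / ((Gamma (3 / 2) * Gamma (y + 1)) * (Gamma (3 / 2) * Gamma (y + 1))) = Gamma_quotient_deriv y"
  proof -
    have "(a * p * (c * b) - a * (c * (b * q))) / (c * b * (c * b)) = a / (c * b) * (p - q)"
      if "c > 0" "b > 0" for a b c p q :: real
      using that by (simp add: field_simps)
    from this[OF G(2,1)] show ?thesis
      by (simp only: Gamma_quotient_deriv_def Gamma_quotient_def)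
  qed
  finally show ?thesis
    by (simp add: Gamma_quotient_def[abs_def])
qed

text \<open>
  Both sides are the derivative of the same function, by the recurrence for \<open>\<Phi>\<close>.
\<close>
lemma Gamma_quotient_deriv_step:
  assumes "y > -1"
  shows "Gamma_quotient (y + 1) + (y + 1) * Gamma_quotient_deriv (y + 1)
       = Gamma_quotient y + (y + 3 / 2) * Gamma_quotient_deriv y"
proof (rule DERIV_unique)
  show "((\<lambda>z. (z + 1) * Gamma_quotient (z + 1)) has_field_derivative
     Gamma_quotient (y + 1) + (y + 1) * Gamma_quotient_deriv (y + 1)) (at y)"
    using assms by (auto intro!: derivative_eq_intros DERIV_chain2[OF DERIV_Gamma_quotient])
  have "((\<lambda>z. (z + 3 / 2) * Gamma_quotient z) has_field_derivative
     Gamma_quotient y + (y + 3 / 2) * Gamma_quotient_deriv y) (at y)"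
    using assms by (auto intro!: derivative_eq_intros DERIV_Gamma_quotient)
  then show "((\<lambda>z. (z + 1) * Gamma_quotient (z + 1)) has_field_derivative
     Gamma_quotient y + (y + 3 / 2) * Gamma_quotient_deriv y) (at y)"
    by (rule has_field_derivative_transform_within_open[where S = "{-1<..}"])
      (use assms in \<open>auto simp: Gamma_quotient_step\<close>)
qed

definition telescoping_error_deriv :: "nat \<Rightarrow> real \<Rightarrow> real" where
  "telescoping_error_deriv K y =
     2 * real K * (real K + 1 / 2) ^ 2 * wallis_ratio K ^ 2 / (y + real K + 3 / 2) ^ 2"

lemma DERIV_telescoping_error:
  assumes "y > -1"
  shows "(telescoping_error K has_field_derivative telescoping_error_deriv K y) (at y)"
proof -
  have nz: "y + real K + 3 / 2 \<noteq> 0" using assms by linarith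
  define c where "c = (real K + 1 / 2) ^ 2 * wallis_ratio K ^ 2"
  have "((\<lambda>z. (2 * z + 3) * c / (z + real K + 3 / 2)) has_field_derivative
     (2 * c * (y + real K + 3 / 2) - (2 * y + 3) * c) / ((y + real K + 3 / 2) * (y + real K + 3 / 2))) (at y)"
    using nz by (auto intro!: derivative_eq_intros)
  also have "2 * c * (y + real K + 3 / 2) - (2 * y + 3) * c = 2 * real K * c"
    by (simp add: algebra_simps)
  finally show ?thesis
    by (simp add: telescoping_error_def[abs_def] telescoping_error_deriv_def c_def power2_eq_square mult_ac)
qed

lemma telescoping_error_deriv_bounds:
  assumes "y > -1"
  shows "0 \<le> telescoping_error_deriv K y" "telescoping_error_deriv K y \<le> 1"
proof -
  show "0 \<le> telescoping_error_deriv K y"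
    unfolding telescoping_error_deriv_def by simp
  have "telescoping_error_deriv K y
      \<le> 2 * real K * (real K + 1 / 2) ^ 2 * (1 / (2 * real K + 1)) / (y + real K + 3 / 2) ^ 2"
    unfolding telescoping_error_deriv_def
    by (intro divide_right_mono mult_left_mono wallis_ratio_sq_le) simp_all
  also have "2 * real K * (real K + 1 / 2) ^ 2 * (1 / (2 * real K + 1)) = real K * (real K + 1 / 2)"
    by (simp add: divide_simps power2_eq_square)
  also have "\<dots> \<le> (y + real K + 3 / 2) * (y + real K + 3 / 2)"
    using assms by (intro mult_mono) simp_all
  then have "real K * (real K + 1 / 2) / (y + real K + 3 / 2) ^ 2 \<le> 1"
    using assms by (subst divide_le_eq_1_pos) (auto simp: power2_eq_square)
  finally show "telescoping_error_deriv K y \<le> 1" .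
qed

text \<open>
  The telescoping identity holds on a neighbourhood of \<open>y\<close>, hence so does its derivative.  The
  logarithmic derivative has a pole at each natural number, which the assumptions keep away from
  \<open>y\<close> and \<open>y + 1\<close>.
\<close>
lemma telescoping_deriv:
  fixes K :: nat and y :: real
  assumes y: "y > -1" "y \<notin> \<nat>" "y + 1 \<notin> \<nat>"
  defines "S \<equiv> \<lambda>z. \<Sum>k\<le>K. series_weight k * poch_quotient k z"
    and "S' \<equiv> \<lambda>z. \<Sum>k\<le>K. series_weight k * (poch_quotient k z * poch_log_deriv k z)"
  shows "S (y + 1) + (y + 1) * S' (y + 1) = S y + (y + 3 / 2) * S' y
      - (telescoping_error_deriv K y * poch_quotient K y
         + telescoping_error K y * (poch_quotient K y * poch_log_deriv K y))"
proof -
  have S: "(S has_field_derivative S' z) (at z)" if "z > -1" "z \<notin> \<nat>" for z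
    unfolding S_def S'_def using that by (intro DERIV_sum DERIV_cmult DERIV_poch_quotient)
  show ?thesis
  proof (rule DERIV_unique)
    have "((\<lambda>z. S (z + 1)) has_field_derivative S' (y + 1) * 1) (at y)"
      using y by (intro DERIV_chain2[OF S]) (auto intro!: derivative_eq_intros)
    then show "((\<lambda>z. (z + 1) * S (z + 1)) has_field_derivative S (y + 1) + (y + 1) * S' (y + 1)) (at y)"
      by (auto intro!: derivative_eq_intros)
    have "((\<lambda>z. (z + 3 / 2) * S z - telescoping_error K z * poch_quotient K z) has_field_derivative
        S y + (y + 3 / 2) * S' y
      - (telescoping_error_deriv K y * poch_quotient K y
         + telescoping_error K y * (poch_quotient K y * poch_log_deriv K y))) (at y)"
      using S[OF y(1,2)] DERIV_poch_quotient[OF y(1,2), of K] DERIV_telescoping_error[OF y(1), of K]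
      by (auto intro!: derivative_eq_intros)
    then show "((\<lambda>z. (z + 1) * S (z + 1)) has_field_derivative
        S y + (y + 3 / 2) * S' y
      - (telescoping_error_deriv K y * poch_quotient K y
         + telescoping_error K y * (poch_quotient K y * poch_log_deriv K y))) (at y)"
      by (rule has_field_derivative_transform_within_open[where S = "{-1<..}"])
        (use y telescoping in \<open>auto simp: S_def\<close>)
  qed
qed

text \<open>
  The formal derivative of the series has the derivative of \<open>\<Phi>\<close> as its sum.  The undifferentiated
  evaluation is included because the differentiated recurrence involves both.
\<close>
definition deriv_sums :: "real \<Rightarrow> bool" where
  "deriv_sums y \<longleftrightarrow>
     (\<lambda>k. series_weight k * poch_quotient k y) sums Gamma_quotient y \<and>
     (\<lambda>k. series_weight k * (poch_quotient k y * poch_log_deriv k y)) sums Gamma_quotient_deriv y"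

lemma telescoping_deriv_error_tendsto_0:
  assumes y: "y > -1" and "(\<lambda>k. poch_quotient k y) \<longlonglongrightarrow> 0"
    and "(\<lambda>k. poch_quotient k y * poch_log_deriv k y) \<longlonglongrightarrow> 0"
  shows "(\<lambda>K. telescoping_error_deriv K y * poch_quotient K y
         + telescoping_error K y * (poch_quotient K y * poch_log_deriv K y)) \<longlonglongrightarrow> 0"
proof -
  have "(\<lambda>K. telescoping_error_deriv K y * poch_quotient K y) \<longlonglongrightarrow> 0"
  proof (rule Lim_null_comparison[OF always_eventually])
    show "(\<lambda>K. \<bar>poch_quotient K y\<bar>) \<longlonglongrightarrow> 0"
      using assms(2) by (rule tendsto_rabs_zero)
    show "\<forall>K. norm (telescoping_error_deriv K y * poch_quotient K y) \<le> \<bar>poch_quotient K y\<bar>"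
      using telescoping_error_deriv_bounds[OF y] by (auto simp: abs_mult intro!: mult_left_le_one_le)
  qed
  from tendsto_add[OF this telescoping_error_tendsto_0[OF y assms(3)]] show ?thesis
    by simp
qed

section \<open>Termwise differentiation at 3/2\<close>

text \<open>
  At \<open>3/2\<close> the terms decay like \<open>k\<close> to the power \<open>-9/2\<close>.  Cubic decay is enough for the
  majorant and holds on a whole interval; it follows from comparing factors with \<open>(k + 1) / (k + 4)\<close>, whose product telescopes.
\<close>
lemma abs_poch_quotient_le_cubic:
  assumes "5 / 4 \<le> y" "y \<le> 7 / 4"
  shows "\<bar>poch_quotient (Suc k) y\<bar> * ((real k + 1) * (real k + 2) * (real k + 3)) \<le> 6"
proof (induction k)
  case 0
  show ?case using assms by (simp add: poch_quotient_Suc divide_simps)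
next
  case (Suc k)
  have "\<bar>y - real (Suc k)\<bar> / \<bar>y + 3 / 2 + real (Suc k)\<bar> \<le> (real k + 1) / (real k + 4)"
  proof (cases "k = 0")
    case True
    then show ?thesis using assms by (simp add: divide_simps)
  next
    case False
    then have k: "real k \<ge> 1" by simp
    have "\<bar>y - real (Suc k)\<bar> / \<bar>y + 3 / 2 + real (Suc k)\<bar> \<le> real k / (real k + 3)"
      using assms k by (intro frac_le) (auto simp: abs_le_iff)
    also have "\<dots> \<le> (real k + 1) / (real k + 4)"
      by (simp add: divide_simps) (simp add: algebra_simps)
    finally show ?thesis .
  qed
  then have "\<bar>poch_quotient (Suc (Suc k)) y\<bar> * ((real (Suc k) + 1) * (real (Suc k) + 2) * (real (Suc k) + 3))
    \<le> (\<bar>poch_quotient (Suc k) y\<bar> * ((real k + 1) / (real k + 4)))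
       * ((real (Suc k) + 1) * (real (Suc k) + 2) * (real (Suc k) + 3))"
    unfolding poch_quotient_Suc[of "Suc k"] abs_mult abs_divide
    by (intro mult_right_mono mult_left_mono) auto
  also have "\<dots> = \<bar>poch_quotient (Suc k) y\<bar> * ((real k + 1) * (real k + 2) * (real k + 3))"
    by (simp add: divide_simps) (simp add: add_ac)
  also have "\<dots> \<le> 6" by (rule Suc.IH)
  finally show ?case .
qed

text \<open>
  The interval has distance \<open>1/4\<close> from the poles at the natural numbers, so each summand is at
  most \<open>4 + 1\<close>.  A linear bound suffices against the cubic decay above.
\<close>
lemma abs_poch_log_deriv_le:
  assumes "5 / 4 \<le> y" "y \<le> 7 / 4"
  shows "\<bar>poch_log_deriv k y\<bar> \<le> 5 * real k"
proof -
  have "\<bar>1 / (y - real j) - 1 / (y + 3 / 2 + real j)\<bar> \<le> 5" for j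
  proof -
    have "1 / 4 \<le> \<bar>y - real j\<bar>"
    proof (cases "j \<le> 1")
      case True
      then have "real j \<le> 1" by simp
      then show ?thesis using assms by linarith
    next
      case False
      then have "real j \<ge> 2" by simp
      then show ?thesis using assms by linarith
    qed
    then have "1 / \<bar>y - real j\<bar> \<le> 1 / (1 / 4)"
      by (intro frac_le) auto
    moreover have "1 / \<bar>y + 3 / 2 + real j\<bar> \<le> 1 / 1"
      using assms by (intro frac_le) auto
    ultimately show ?thesis
      using abs_triangle_ineq4[of "1 / (y - real j)" "1 / (y + 3 / 2 + real j)"] by simp
  qed
  then have "\<bar>poch_log_deriv k y\<bar> \<le> (\<Sum>j<k. 5)"
    unfolding poch_log_deriv_def by (intro order.trans[OF sum_abs sum_mono]) auto
  then show ?thesis by simp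
qed

lemma deriv_term_bound:
  assumes "5 / 4 \<le> y" "y \<le> 7 / 4"
  shows "\<bar>series_weight k * (poch_quotient k y * poch_log_deriv k y)\<bar> \<le> 60 * (1 / real (Suc k) ^ 2)"
proof (cases k)
  case 0
  then show ?thesis by (simp add: poch_log_deriv_def)
next
  case (Suc m)
  have "\<bar>series_weight k * (poch_quotient k y * poch_log_deriv k y)\<bar>
     \<le> 2 * (\<bar>poch_quotient k y\<bar> * (5 * real k))"
    unfolding abs_mult using series_weight_le_2[of k] series_weight_ge_1[of k] abs_poch_log_deriv_le[OF assms, of k]
    by (intro mult_mono) auto
  also have "\<bar>poch_quotient k y\<bar> \<le> 6 / ((real m + 1) * (real m + 2) * (real m + 3))"
    using abs_poch_quotient_le_cubic[OF assms, of m] Suc by (subst pos_le_divide_eq) auto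
  then have "2 * (\<bar>poch_quotient k y\<bar> * (5 * real k))
     \<le> 2 * (6 / ((real m + 1) * (real m + 2) * (real m + 3)) * (5 * real k))"
    by (intro mult_left_mono mult_right_mono) auto
  also have "\<dots> = 60 / ((real m + 2) * (real m + 3))"
    using Suc by (simp add: divide_simps)
  also have "\<dots> \<le> 60 / ((real m + 2) * (real m + 2))"
    by (intro divide_left_mono mult_left_mono) auto
  also have "\<dots> = 60 * (1 / real (Suc k) ^ 2)"
    using Suc by (simp add: power2_eq_square add_ac)
  finally show ?thesis .
qed

text \<open>
  At \<open>3/2\<close> and nearby the differentiated series converges absolutely and uniformly, which
  justifies differentiating the evaluation term by term.  At \<open>-1/2\<close>, the parameter for \<open>n = 0\<close>, convergence is only
  conditional and this argument is not available.
\<close>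
lemma deriv_sums_three_halves: "deriv_sums (3 / 2)"
proof -
  let ?I = "{5 / 4..7 / 4 :: real}"
  let ?f = "\<lambda>k y. series_weight k * poch_quotient k y"
  let ?f' = "\<lambda>k y. series_weight k * (poch_quotient k y * poch_log_deriv k y)"
  have nonint: "y \<notin> \<nat>" if "y \<in> ?I" for y :: real
  proof
    assume "y \<in> \<nat>"
    then obtain n where "y = real n" by (auto elim: Nats_cases)
    then have "4 * n \<ge> 5" "4 * n \<le> 7" using that by simp_all
    then show False by presburger
  qed
  have M: "summable (\<lambda>k. 60 * (1 / real (Suc k) ^ 2))"
    using inverse_power_summable[of 2, where ?'a = real]
    by (intro summable_mult) (simp add: summable_Suc_iff[of "\<lambda>k. 1 / real k ^ 2", symmetric] inverse_eq_divide)
  have U: "uniformly_convergent_on ?I (\<lambda>n y. \<Sum>k<n. ?f' k y)"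
    using M deriv_term_bound by (intro Weierstrass_m_test'_ev always_eventually) auto
  have D: "((\<lambda>y. \<Sum>k. ?f k y) has_field_derivative (\<Sum>k. ?f' k (3 / 2))) (at (3 / 2))"
  proof (rule has_field_derivative_series'(2)[of ?I _ _ "3 / 2"])
    show "(?f k has_field_derivative ?f' k y) (at y within ?I)" if "y \<in> ?I" for k y
      using that nonint[OF that] by (intro DERIV_cmult has_field_derivative_at_within[OF DERIV_poch_quotient]) auto
    show "summable (\<lambda>k. ?f k (3 / 2))"
      using sums_Gamma_quotient[of "3 / 2"] by (simp add: sums_iff)
  qed (use U in auto)
  have "((\<lambda>y. \<Sum>k. ?f k y) has_field_derivative Gamma_quotient_deriv (3 / 2)) (at (3 / 2))"
    by (rule has_field_derivative_transform_within_open[OF DERIV_Gamma_quotient, where S = "{0<..}"])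
      (use sums_Gamma_quotient in \<open>auto simp: sums_iff\<close>)
  with D have "(\<Sum>k. ?f' k (3 / 2)) = Gamma_quotient_deriv (3 / 2)"
    by (rule DERIV_unique)
  moreover have "summable (\<lambda>k. ?f' k (3 / 2))"
    using deriv_term_bound[of "3 / 2"] by (intro summable_comparison_test[OF _ M]) auto
  ultimately show ?thesis
    using sums_Gamma_quotient[of "3 / 2"] by (simp add: deriv_sums_def sums_iff)
qed

section \<open>Transfer to all half-integers\<close>

text \<open>
  Once the boundary terms vanish, the differentiated telescoping identity determines the limit of
  either differentiated series from the other one.
\<close>
lemma deriv_sums_step_iff:
  assumes y: "y > -1" "y \<notin> \<nat>" "y + 1 \<notin> \<nat>"
    and S: "(\<lambda>k. series_weight k * poch_quotient k y) sums Gamma_quotient y"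
    and lim: "(\<lambda>k. poch_quotient k y * poch_log_deriv k y) \<longlonglongrightarrow> 0"
  shows "deriv_sums (y + 1) \<longleftrightarrow> deriv_sums y"
proof -
  let ?S = "\<lambda>y K. \<Sum>k\<le>K. series_weight k * poch_quotient k y"
  let ?S' = "\<lambda>y K. \<Sum>k\<le>K. series_weight k * (poch_quotient k y * poch_log_deriv k y)"
  let ?e = "\<lambda>K. telescoping_error_deriv K y * poch_quotient K y
         + telescoping_error K y * (poch_quotient K y * poch_log_deriv K y)"
  have S1: "(\<lambda>k. series_weight k * poch_quotient k (y + 1)) sums Gamma_quotient (y + 1)"
    using sums_step[OF y(1) S] Gamma_quotient_step[OF y(1)] by simp
  have lims: "?S y \<longlonglongrightarrow> Gamma_quotient y" "?S (y + 1) \<longlonglongrightarrow> Gamma_quotient (y + 1)"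
    using S S1 by (simp_all add: sums_def_le)
  have e: "?e \<longlonglongrightarrow> 0"
    by (intro telescoping_deriv_error_tendsto_0 y lim tendsto_0_if_weighted_summable sums_summable[OF S])
  have T: "?S (y + 1) K + (y + 1) * ?S' (y + 1) K = ?S y K + (y + 3 / 2) * ?S' y K - ?e K" for K
    using telescoping_deriv[OF y, of K] .
  have "?S' (y + 1) \<longlonglongrightarrow> Gamma_quotient_deriv (y + 1)"
    if "?S' y \<longlonglongrightarrow> Gamma_quotient_deriv y"
  proof -
    have "(\<lambda>K. (?S y K + (y + 3 / 2) * ?S' y K - ?e K - ?S (y + 1) K) / (y + 1))
        \<longlonglongrightarrow> (Gamma_quotient y + (y + 3 / 2) * Gamma_quotient_deriv y - 0 - Gamma_quotient (y + 1)) / (y + 1)"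
      using y by (intro tendsto_divide tendsto_diff tendsto_add tendsto_mult tendsto_const lims e that) simp
    also have "(Gamma_quotient y + (y + 3 / 2) * Gamma_quotient_deriv y - 0 - Gamma_quotient (y + 1)) / (y + 1)
       = Gamma_quotient_deriv (y + 1)"
      using y by (subst Gamma_quotient_deriv_step[symmetric]) simp_all
    also have "(\<lambda>K. (?S y K + (y + 3 / 2) * ?S' y K - ?e K - ?S (y + 1) K) / (y + 1)) = ?S' (y + 1)"
      unfolding T[symmetric] using y by simp
    finally show ?thesis .
  qed
  moreover have "?S' y \<longlonglongrightarrow> Gamma_quotient_deriv y"
    if "?S' (y + 1) \<longlonglongrightarrow> Gamma_quotient_deriv (y + 1)"
  proof -
    have T': "?S (y + 1) K + (y + 1) * ?S' (y + 1) K + ?e K - ?S y K = (y + 3 / 2) * ?S' y K" for K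
      unfolding T by simp
    have "(\<lambda>K. (?S (y + 1) K + (y + 1) * ?S' (y + 1) K + ?e K - ?S y K) / (y + 3 / 2))
        \<longlonglongrightarrow> (Gamma_quotient (y + 1) + (y + 1) * Gamma_quotient_deriv (y + 1) + 0 - Gamma_quotient y) / (y + 3 / 2)"
      using y by (intro tendsto_divide tendsto_diff tendsto_add tendsto_mult tendsto_const lims e that) simp
    also have "(Gamma_quotient (y + 1) + (y + 1) * Gamma_quotient_deriv (y + 1) + 0 - Gamma_quotient y) / (y + 3 / 2)
       = Gamma_quotient_deriv y"
      using y by (subst Gamma_quotient_deriv_step) simp_all
    also have "(\<lambda>K. (?S (y + 1) K + (y + 1) * ?S' (y + 1) K + ?e K - ?S y K) / (y + 3 / 2)) = ?S' y"
      unfolding T' using y by simp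
    finally show ?thesis .
  qed
  ultimately show ?thesis
    unfolding deriv_sums_def sums_def_le using S S1 by (auto simp: sums_def_le)
qed

lemma half_integer_not_Nats: "real n - 1 / 2 \<notin> \<nat>"
proof
  assume "real n - 1 / 2 \<in> \<nat>"
  then obtain m where "real n - 1 / 2 = real m" by (auto elim: Nats_cases)
  then have "2 * n = 2 * m + 1" by linarith
  then show False by presburger
qed

text \<open>
  These are the two parameters that are reached by going down from \<open>3/2\<close>.  There, convergence of the
  differentiated series is not yet known, so the boundary terms are estimated directly.  The
  logarithmic derivative is of harmonic size since \<open>y\<close> keeps distance \<open>(j + 1)/4\<close> from each pole \<open>j\<close>.
\<close>
lemma log_deriv_times_quotient_tendsto_0:
  assumes "y = - 1 / 2 \<or> y = 1 / 2"
  shows "(\<lambda>k. poch_quotient k y * poch_log_deriv k y) \<longlonglongrightarrow> 0"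
proof (rule Lim_null_comparison[OF always_eventually])
  show "(\<lambda>k. 5 * (harm k * wallis_ratio k)) \<longlonglongrightarrow> 0"
    by (intro tendsto_mult_right_zero harm_wallis_ratio_tendsto_0)
  show "\<forall>k. norm (poch_quotient k y * poch_log_deriv k y) \<le> 5 * (harm k * wallis_ratio k)"
  proof
    fix k
    have "\<bar>1 / (y - real j) - 1 / (y + 3 / 2 + real j)\<bar> \<le> 5 * inverse (real (Suc j))" for j
    proof -
      have "(real j + 1) / 4 \<le> \<bar>y - real j\<bar>" "real j + 1 \<le> \<bar>y + 3 / 2 + real j\<bar>"
        using assms by (cases "j = 0"; auto)+
      then have "1 / \<bar>y - real j\<bar> \<le> 1 / ((real j + 1) / 4)" "1 / \<bar>y + 3 / 2 + real j\<bar> \<le> 1 / (real j + 1)"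
        by (intro frac_le; simp)+
      then show ?thesis
        using abs_triangle_ineq4[of "1 / (y - real j)" "1 / (y + 3 / 2 + real j)"]
        by (simp add: inverse_eq_divide add.commute)
    qed
    then have "\<bar>poch_log_deriv k y\<bar> \<le> (\<Sum>j<k. 5 * inverse (real (Suc j)))"
      unfolding poch_log_deriv_def by (intro order.trans[OF sum_abs sum_mono]) auto
    also have "\<dots> = 5 * harm k"
      by (simp add: harm_altdef sum_distrib_left)
    finally have "\<bar>poch_log_deriv k y\<bar> \<le> 5 * harm k" .
    then have "\<bar>poch_quotient k y\<bar> * \<bar>poch_log_deriv k y\<bar> \<le> wallis_ratio k * (5 * harm k)"
      using assms wallis_ratio_pos[of k] by (intro mult_mono abs_poch_quotient_le_wallis_ratio) auto
    then show "norm (poch_quotient k y * poch_log_deriv k y) \<le> 5 * (harm k * wallis_ratio k)"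
      by (simp add: abs_mult mult_ac)
  qed
qed

text \<open>
  From \<open>3/2\<close> the evaluation is carried down to \<open>1/2\<close> and \<open>-1/2\<close>, and then up from \<open>-1/2\<close>.  On the
  way up the boundary terms vanish because the series at the lower parameter converges.
\<close>
theorem deriv_sums_half_integer: "deriv_sums (real n - 1 / 2)"
proof -
  have step: "deriv_sums (real n + 1 / 2) \<longleftrightarrow> deriv_sums (real n - 1 / 2)"
    if "(\<lambda>k. series_weight k * poch_quotient k (real n - 1 / 2)) sums Gamma_quotient (real n - 1 / 2)"
       "(\<lambda>k. poch_quotient k (real n - 1 / 2) * poch_log_deriv k (real n - 1 / 2)) \<longlonglongrightarrow> 0" for n
    using deriv_sums_step_iff[of "real n - 1 / 2"] that half_integer_not_Nats[of n] half_integer_not_Nats[of "Suc n"]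
    by (simp add: algebra_simps)
  have "deriv_sums (1 / 2)"
    using step[of 1] deriv_sums_three_halves sums_Gamma_quotient[of "1 / 2"] log_deriv_times_quotient_tendsto_0[of "1 / 2"]
    by simp
  then have "deriv_sums (- 1 / 2)"
    using step[of 0] sums_Gamma_quotient_minus_half log_deriv_times_quotient_tendsto_0[of "- 1 / 2"]
    by simp
  then show ?thesis
  proof (induction n)
    case (Suc n)
    then have d: "deriv_sums (real n - 1 / 2)" by simp
    then have "(\<lambda>k. poch_quotient k (real n - 1 / 2) * poch_log_deriv k (real n - 1 / 2)) \<longlonglongrightarrow> 0"
      by (intro tendsto_0_if_weighted_summable) (auto simp: deriv_sums_def sums_iff)
    then have "deriv_sums (real n + 1 / 2)"
      using step[of n] d by (simp add: deriv_sums_def)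
    then show ?case by (simp add: algebra_simps)
  qed simp
qed

section \<open>Translation to harmonic numbers\<close>

text \<open>
  For negative \<open>j\<close> this is the recurrence at positive indices, reflected by the evenness of \<open>odd_harm\<close>.
\<close>
lemma odd_harm_add_1: "odd_harm (j + 1) = odd_harm j + 1 / (2 * real_of_int j + 1)"
proof (cases "j \<ge> 0")
  case True
  then show ?thesis
    using odd_harm_Suc[of "nat j"] by (simp add: add.commute)
next
  case False
  define m where "m = nat (- j - 1)"
  have j: "j = - int (Suc m)" using False by (simp add: m_def)
  have "odd_harm (j + 1) = odd_harm (int m)" "odd_harm j = odd_harm (int (Suc m))"
    unfolding j using odd_harm_uminus[of "int m"] odd_harm_uminus[of "int (Suc m)"] by simp_all
  moreover have "1 / (2 * real_of_int j + 1) = - (1 / (2 * real (Suc m) - 1))"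
    unfolding j by (simp add: divide_simps)
  ultimately show ?thesis
    using odd_harm_Suc[of m] by simp
qed

lemma odd_difference_nonzero: "2 * real k - 2 * real n + 1 \<noteq> 0"
proof -
  have "2 * int k - 2 * int n + 1 \<noteq> 0" by presburger
  then have "real_of_int (2 * int k - 2 * int n + 1) \<noteq> 0" by linarith
  then show ?thesis by simp
qed

text \<open>
  At half-integers the two sums of reciprocals in the logarithmic derivative are differences of
  odd harmonic and harmonic numbers: this is where the factor \<open>2 O(k - n) + H(k + n)\<close> comes from.
\<close>
lemma poch_log_deriv_half_integer:
  "poch_log_deriv k (real n - 1 / 2)
     = (2 * odd_harm (int n) + harm n) - (2 * odd_harm (int k - int n) + harm (k + n))"
proof (induction k)
  case 0
  show ?case by (simp add: poch_log_deriv_def odd_harm_uminus)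
next
  case (Suc k)
  have nz: "2 * real k - 2 * real n + 1 \<noteq> 0" "real n - 1 / 2 - real k \<noteq> 0"
    using odd_difference_nonzero[of k n] by linarith+
  have o: "odd_harm (int (Suc k) - int n) = odd_harm (int k - int n) + 1 / (2 * real k - 2 * real n + 1)"
    using odd_harm_add_1[of "int k - int n"] by (simp add: algebra_simps)
  have "1 / (real n - 1 / 2 - real k) = - 2 * (1 / (2 * real k - 2 * real n + 1))"
    using nz by (simp add: field_simps)
  moreover have "1 / (real n - 1 / 2 + 3 / 2 + real k) = inverse (real (Suc (k + n)))"
    by (simp add: inverse_eq_divide algebra_simps)
  ultimately show ?case
    using Suc.IH o by (simp add: poch_log_deriv_def harm_Suc)
qed

definition denom_prod :: "nat \<Rightarrow> nat \<Rightarrow> real" where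
  "denom_prod n k = (\<Prod>j=1..n. (real k + real j) * (2 * real k - 2 * real j + 1))"

lemma denom_prod_nonzero: "denom_prod n k \<noteq> 0"
  using odd_difference_nonzero[of k] unfolding denom_prod_def by (auto simp: prod_zero_iff)

lemma denom_prod_Suc:
  "denom_prod n (Suc k) * ((real k + 1) * (2 * real k - 2 * real n + 1))
     = denom_prod n k * ((real k + real n + 1) * (2 * real k + 1))"
proof (induction n)
  case (Suc n)
  have "denom_prod (Suc n) (Suc k) * ((real k + 1) * (2 * real k - 2 * real (Suc n) + 1))
     = denom_prod n (Suc k) * ((real k + 1) * (2 * real k - 2 * real n + 1))
         * ((real k + real n + 2) * (2 * real k - 2 * real n - 1))"
    by (simp add: denom_prod_def algebra_simps)
  also have "\<dots> = denom_prod (Suc n) k * ((real k + real (Suc n) + 1) * (2 * real k + 1))"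
    unfolding Suc.IH by (simp add: denom_prod_def algebra_simps)
  finally show ?case .
qed (simp add: denom_prod_def)

lemma denom_prod_0: "denom_prod n 0 = (-1) ^ n * (2 ^ n * fact n * pochhammer (1 / 2) n)"
proof (induction n)
  case (Suc n)
  have "denom_prod (Suc n) 0 = denom_prod n 0 * ((real n + 1) * (- 2 * (1 / 2 + real n)))"
    by (simp add: denom_prod_def algebra_simps)
  then show ?case
    unfolding Suc.IH pochhammer_Suc by (simp add: field_simps)
qed (simp add: denom_prod_def)

text \<open>
  Up to a factor that is independent of \<open>k\<close>, the product in the denominator converts one of the
  three Wallis ratios into the Pochhammer quotient at \<open>n - 1/2\<close>.
\<close>
lemma poch_quotient_half_integer:
  "(-1) ^ k * wallis_ratio k / denom_prod n k = poch_quotient k (real n - 1 / 2) / denom_prod n 0"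
proof (induction k)
  case (Suc k)
  note nz = odd_difference_nonzero[of k n]
  have d: "denom_prod n (Suc k) = denom_prod n k * ((real k + real n + 1) * (2 * real k + 1))
       / ((real k + 1) * (2 * real k - 2 * real n + 1))"
    using denom_prod_Suc[of n k] nz by (subst nonzero_eq_divide_eq) auto
  have "(-1) ^ Suc k * wallis_ratio (Suc k) / denom_prod n (Suc k)
     = (-1) ^ k * wallis_ratio k / denom_prod n k * ((real n - 1 / 2 - real k) / (real n - 1 / 2 + 3 / 2 + real k))"
    unfolding d wallis_ratio_Suc using nz denom_prod_nonzero[of n k]
    by (simp add: divide_simps) (simp add: algebra_simps)
  also have "\<dots> = poch_quotient (Suc k) (real n - 1 / 2) / denom_prod n 0"
    unfolding Suc.IH by (simp add: poch_quotient_Suc)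
  finally show ?case .
qed simp

lemma Gamma_quotient_half_integer:
  "Gamma_quotient (real n - 1 / 2) = 2 * fact n / (pi * pochhammer (1 / 2) n)"
proof -
  have half: "(1 / 2 :: real) \<notin> \<int>\<^sub>\<le>\<^sub>0"
    by (auto dest: nonpos_Ints_nonpos)
  have "Gamma (real n + 1 / 2) = pochhammer (1 / 2) n * sqrt pi"
    using pochhammer_Gamma[OF half, of n] Gamma_one_half_real by (simp add: add.commute)
  moreover have "Gamma (3 / 2 :: real) = sqrt pi / 2"
    using Gamma_plus1[OF half] Gamma_one_half_real by simp
  moreover have "Gamma (real n + 1) = fact n"
    using Gamma_fact[of n, where ?'a = real] by (simp add: add.commute)
  moreover have "real n - 1 / 2 + 3 / 2 = real n + 1" "real n - 1 / 2 + 1 = real n + 1 / 2"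
    by simp_all
  ultimately show ?thesis
    unfolding Gamma_quotient_def by (simp only:) (simp add: field_simps)
qed

lemma Gamma_quotient_deriv_half_integer:
  "Gamma_quotient_deriv (real n - 1 / 2)
     = Gamma_quotient (real n - 1 / 2) * (harm n - 2 * odd_harm (int n) + 2 * ln 2)"
proof -
  have "Digamma (real n - 1 / 2 + 1) = 2 * odd_harm (int n) - 2 * ln 2 - euler_mascheroni"
    using harmonic_half_nonneg[of n] by (simp add: harmonic_def)
  moreover have "Digamma (real n - 1 / 2 + 3 / 2) = harm n - euler_mascheroni"
    using Digamma_of_nat[of n, where ?'a = real] by (simp add: add.commute)
  ultimately show ?thesis by (simp add: Gamma_quotient_deriv_def)
qed

lemma harm_double: "harm (2 * k) = odd_harm (int k) + harm k / 2"
proof (induction k)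
  case (Suc k)
  have "harm (2 * Suc k) = harm (2 * k) + inverse (real (2 * k + 1)) + inverse (real (2 * k + 2))"
    by (simp add: harm_Suc)
  moreover have "odd_harm (int (Suc k)) = odd_harm (int k) + inverse (real (2 * k + 1))"
    using odd_harm_Suc[of k] by (simp add: inverse_eq_divide)
  moreover have "inverse (real (2 * k + 2)) = inverse (real (Suc k)) / 2"
    by (simp add: field_simps)
  ultimately show ?case
    by (simp only: Suc.IH harm_Suc) simp
qed (simp add: odd_harm_def harm_expand)

lemma sums_with_denom_prod:
  "(\<lambda>k. (-1) ^ k * pochhammer (1 / 2 :: real) k ^ 3 * (4 * real k + 1)
             * (2 * odd_harm (int k - int n) + harm (k + n))
           / (fact k ^ 3 * denom_prod n k))
      sums ((-1) ^ n / 2 powi (int n - 2) * (1 / pochhammer (1 / 2) n ^ 2)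
         * (2 * odd_harm (int n) - ln 2) * (1 / pi))"
proof -
  let ?y = "real n - 1 / 2"
  let ?c = "2 * odd_harm (int n) + harm n"
  \<comment> \<open>The combination \<open>?c \<Phi> - \<Phi>\'\<close> cancels the part of the logarithmic derivative that is constant in \<open>k\<close>.\<close>
  have "(\<lambda>k. (?c * (series_weight k * poch_quotient k ?y)
          - series_weight k * (poch_quotient k ?y * poch_log_deriv k ?y)) / denom_prod n 0)
     sums ((?c * Gamma_quotient ?y - Gamma_quotient_deriv ?y) / denom_prod n 0)"
    using deriv_sums_half_integer[of n] unfolding deriv_sums_def
    by (intro sums_divide sums_diff sums_mult) auto
  also have "(\<lambda>k. (?c * (series_weight k * poch_quotient k ?y)
          - series_weight k * (poch_quotient k ?y * poch_log_deriv k ?y)) / denom_prod n 0)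
     = (\<lambda>k. (-1) ^ k * pochhammer (1 / 2 :: real) k ^ 3 * (4 * real k + 1)
             * (2 * odd_harm (int k - int n) + harm (k + n)) / (fact k ^ 3 * denom_prod n k))"
  proof
    fix k
    let ?X = "2 * odd_harm (int k - int n) + harm (k + n)"
    have "(?c * (series_weight k * poch_quotient k ?y)
          - series_weight k * (poch_quotient k ?y * poch_log_deriv k ?y)) / denom_prod n 0
       = series_weight k * ?X * (poch_quotient k ?y / denom_prod n 0)"
      unfolding poch_log_deriv_half_integer by (simp add: algebra_simps add_divide_distrib diff_divide_distrib)
    also have "\<dots> = series_weight k * ?X * ((-1) ^ k * wallis_ratio k / denom_prod n k)"
      by (simp only: poch_quotient_half_integer)
    also have "\<dots> = (-1) ^ k * pochhammer (1 / 2 :: real) k ^ 3 * (4 * real k + 1) * ?X / (fact k ^ 3 * denom_prod n k)"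
      by (simp add: series_weight_def wallis_ratio_def power2_eq_square power3_eq_cube mult_ac)
    finally show "(?c * (series_weight k * poch_quotient k ?y)
          - series_weight k * (poch_quotient k ?y * poch_log_deriv k ?y)) / denom_prod n 0
       = (-1) ^ k * pochhammer (1 / 2 :: real) k ^ 3 * (4 * real k + 1) * ?X / (fact k ^ 3 * denom_prod n k)" .
  qed
  also have "(?c * Gamma_quotient ?y - Gamma_quotient_deriv ?y) / denom_prod n 0
     = (-1) ^ n / 2 powi (int n - 2) * (1 / pochhammer (1 / 2) n ^ 2)
         * (2 * odd_harm (int n) - ln 2) * (1 / pi)"
  proof -
    have num: "?c * Gamma_quotient ?y - Gamma_quotient_deriv ?y
        = 2 * fact n / (pi * pochhammer (1 / 2) n) * (2 * (2 * odd_harm (int n) - ln 2))"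
      unfolding Gamma_quotient_deriv_half_integer Gamma_quotient_half_integer[symmetric] by (simp add: algebra_simps)
    have two: "(2 :: real) powi (int n - 2) = 2 ^ n / 4"
      by (simp add: power_int_diff)
    have pos: "pochhammer (1 / 2 :: real) n > 0" by (rule pochhammer_pos) simp
    have sign: "1 / (-1) ^ n = ((-1) ^ n :: real)" by (cases "even n") auto
    have "2 * fact n / (pi * p) * (2 * X) / (s * (2 ^ n * fact n * p)) = (1 / s) / (2 ^ n / 4) * (1 / p ^ 2) * X * (1 / pi)"
      if "p > 0" "s \<noteq> 0" for p s X :: real
      using that by (simp add: divide_simps power2_eq_square)
    from this[OF pos, of "(-1) ^ n" "2 * odd_harm (int n) - ln 2"] show ?thesis
      unfolding num two denom_prod_0 by (simp only: sign) simp
  qed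
  finally show ?thesis .
qed

theorem corollary4:
  shows "(\<forall>n::nat.
      (\<lambda>k. (-1) ^ k * pochhammer (1 / 2 :: real) k ^ 3 * (4 * real k + 1)
             * (2 * odd_harm (int k - int n) + harm (k + n))
           / (fact k ^ 3 * (\<Prod>j=1..n. (real k + real j) * (2 * real k - 2 * real j + 1))))
      sums
      ((-1) ^ n / 2 powi (int n - 2) * (1 / pochhammer (1 / 2) n ^ 2)
         * (2 * odd_harm (int n) - ln 2) * (1 / pi)))
    \<and>
    (\<lambda>k. (-1) ^ k * (pochhammer (1 / 2 :: real) k ^ 3 / fact k ^ 3) * (4 * real k + 1) * harm (2 * k))
      sums (- (2 / pi) * ln 2)"
proof (intro conjI allI)
  fix n
  show "(\<lambda>k. (-1) ^ k * pochhammer (1 / 2 :: real) k ^ 3 * (4 * real k + 1)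
             * (2 * odd_harm (int k - int n) + harm (k + n))
           / (fact k ^ 3 * (\<Prod>j=1..n. (real k + real j) * (2 * real k - 2 * real j + 1))))
      sums
      ((-1) ^ n / 2 powi (int n - 2) * (1 / pochhammer (1 / 2) n ^ 2)
         * (2 * odd_harm (int n) - ln 2) * (1 / pi))"
    using sums_with_denom_prod[of n] by (simp only: denom_prod_def)
next
  show "(\<lambda>k. (-1) ^ k * (pochhammer (1 / 2 :: real) k ^ 3 / fact k ^ 3) * (4 * real k + 1) * harm (2 * k))
      sums (- (2 / pi) * ln 2)"
  proof -
    have "(1 / 2) * ((-1) ^ k * pochhammer (1 / 2 :: real) k ^ 3 * (4 * real k + 1)
             * (2 * odd_harm (int k - int 0) + harm (k + 0)) / (fact k ^ 3 * denom_prod 0 k))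
        = (-1) ^ k * (pochhammer (1 / 2 :: real) k ^ 3 / fact k ^ 3) * (4 * real k + 1) * harm (2 * k)" for k
      unfolding harm_double by (simp add: denom_prod_def field_simps)
    moreover have "(1 / 2) * ((-1) ^ 0 / 2 powi (int 0 - 2) * (1 / pochhammer (1 / 2) 0 ^ 2)
         * (2 * odd_harm (int 0) - ln 2) * (1 / pi)) = - (2 / pi) * ln 2"
      by (simp add: odd_harm_def power_int_def field_simps)
    ultimately show ?thesis
      using sums_mult[OF sums_with_denom_prod[of 0], of "1 / 2"] by (simp only:)
  qed
qed

end
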